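(* Let $P=(\varphi_n)_{n=0}^\infty$ be a fixed sequence of functions as in the context. Let $x_0\in(0,1)\setminus IS^{P^-}$, let $(x_n)_{n=1}^\infty$ be a sequence of numbers from $(0,1)\setminus\left(IS^{P^-}\cup\{x_0\}\right)$, and for each $n\in\mathbb{N}$ let $k_n$ be the minimum number $j\in\mathbb{N}$ such that $q_j(x_n)\neq q_j(x_0)$. Then $$\lim_{n\to\infty}x_n=x_0\iff\lim_{n\to\infty}k_n=\infty.$$
   Context: $\mathbb{N}=\{1,2,3,\ldots\}$. Fix a sequence $P=(\varphi_n)_{n=0}^\infty$, where $\varphi_0\in\mathbb{N}$ is a constant and, for $n\ge 1$, $\varphi_n\colon\mathbb{N}^n\to\mathbb{N}$ is an arbitrary function. The $P^-$-representation (alternating Perron expansion) of $x\in(0,1]$ is an expansion $$x=\sum_{n=0}^{\infty}\frac{(-1)^n r_0 r_1\cdots r_n}{(q_1-1)q_1\cdots(q_n-1)q_n\,(q_{n+1}-1)},$$ where $q_1,q_2,\ldots\in\mathbb{N}$, $r_0=\varphi_0$, $r_n=\varphi_n(q_1,\ldots,q_n)$ and $q_n\ge r_{n-1}+1$ for all $n\in\mathbb{N}$ (the $n=0$ term is $r_0/(q_1-1)$). $IS^{P^-}\subset(0,1]$ denotes the set of numbers in $(0,1]$ that have no $P^-$-representation; it is known to be countably infinite. It is known that every $x\in(0,1)\setminus IS^{P^-}$ has a unique $P^-$-representation; the number $q_n=q_n(x)$ is called the $n$th $P^-$-digit of $x$. *)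

theory Defs
  imports Complex_Main
begin

text \<open>
  The positive integers are modelled as the elements \<open>\<ge> 1\<close> of \<^typ>\<open>nat\<close>. The function of \<open>n\<close> positive
  integer arguments is \<open>\<phi> n\<close>, applied to lists of length \<open>n\<close>; the initial constant is \<open>\<phi> 0 []\<close>.
  Values on other lists are irrelevant.
\<close>

definition perron_functions :: "(nat \<Rightarrow> nat list \<Rightarrow> nat) \<Rightarrow> bool" where
  "perron_functions \<phi> \<longleftrightarrow>
     (\<forall>n qs. length qs = n \<and> (\<forall>q\<in>set qs. q \<ge> 1) \<longrightarrow> \<phi> n qs \<ge> 1)"

text \<open>Digit sequences are indexed from 1; the value \<open>q 0\<close> is never used.\<close>

definition perron_r :: "(nat \<Rightarrow> nat list \<Rightarrow> nat) \<Rightarrow> (nat \<Rightarrow> nat) \<Rightarrow> nat \<Rightarrow> nat" where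
  "perron_r \<phi> q n = \<phi> n (map q [1..<Suc n])"

definition perron_minus_rep ::
  "(nat \<Rightarrow> nat list \<Rightarrow> nat) \<Rightarrow> (nat \<Rightarrow> nat) \<Rightarrow> real \<Rightarrow> bool" where
  "perron_minus_rep \<phi> q x \<longleftrightarrow>
     (\<forall>n\<ge>1. q n \<ge> 1 \<and> q n \<ge> perron_r \<phi> q (n - 1) + 1) \<and>
     (\<lambda>n. (-1) ^ n * (\<Prod>i=0..n. real (perron_r \<phi> q i)) /
          ((\<Prod>i=1..n. (real (q i) - 1) * real (q i)) * (real (q (n + 1)) - 1))) sums x"

definition perron_minus_IS :: "(nat \<Rightarrow> nat list \<Rightarrow> nat) \<Rightarrow> real set" where
  "perron_minus_IS \<phi> = {x \<in> {0<..1}. \<not> (\<exists>q. perron_minus_rep \<phi> q x)}"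

text \<open>
  The description ranges over the single digit rather than over the whole digit sequence, since
  \<open>q 0\<close> is unconstrained. It is meaningful for \<open>n \<ge> 1\<close>.
\<close>

definition perron_minus_digit :: "(nat \<Rightarrow> nat list \<Rightarrow> nat) \<Rightarrow> nat \<Rightarrow> real \<Rightarrow> nat" where
  "perron_minus_digit \<phi> n x = (THE d. \<exists>q. perron_minus_rep \<phi> q x \<and> q n = d)"

end

theory Submission
  imports Defs
begin

text \<open>
  The proof rests on the self-similarity of the expansion. Splitting off the first term gives
  \<open>x = r\<^sub>0/(q\<^sub>1 - 1) - r\<^sub>0/((q\<^sub>1 - 1) q\<^sub>1) \<cdot> y\<close>, where \<open>y\<close> has the digits \<open>q\<^sub>2, q\<^sub>3, \<dots>\<close> with respect to
  the functions obtained by fixing the first argument to be \<open>q\<^sub>1\<close> (\<open>perron_minus_rep_shift\<close>). Every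
  represented number lies strictly between 0 and 1; applied to \<open>y\<close>, this places \<open>x\<close> strictly
  between \<open>r\<^sub>0/q\<^sub>1\<close> and \<open>r\<^sub>0/(q\<^sub>1 - 1)\<close> (\<open>perron_minus_rep_first_digit_bounds\<close>). For different values
  of \<open>q\<^sub>1\<close> these open intervals are disjoint, so the first digit, and by recursion every digit, is
  determined by \<open>x\<close>.

  Both directions of the equivalence follow from the same affine relation. Its slope is at most
  \<open>1/q\<^sub>1 \<le> 1/2\<close> in absolute value, so two numbers that share \<open>m\<close> digits differ by at most \<open>2\<^sup>-\<^sup>m\<close>
  (\<open>perron_minus_rep_dist_le\<close>). Conversely, the intervals are open and \<open>y\<close> depends continuously on
  \<open>x\<close>, so all represented numbers close enough to \<open>x\<close> share its first \<open>m\<close> digits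
  (\<open>perron_minus_rep_eventually_same_digits\<close>).
\<close>

section \<open>Splitting off the first digit\<close>

definition perron_shift :: "(nat \<Rightarrow> nat list \<Rightarrow> nat) \<Rightarrow> nat \<Rightarrow> nat \<Rightarrow> nat list \<Rightarrow> nat" where
  "perron_shift \<phi> d n qs = \<phi> (Suc n) (d # qs)"

definition perron_term :: "(nat \<Rightarrow> nat list \<Rightarrow> nat) \<Rightarrow> (nat \<Rightarrow> nat) \<Rightarrow> nat \<Rightarrow> real" where
  "perron_term \<phi> q n = (-1) ^ n * (\<Prod>i=0..n. real (perron_r \<phi> q i)) /
     ((\<Prod>i=1..n. (real (q i) - 1) * real (q i)) * (real (q (n + 1)) - 1))"

definition admissible_digits :: "(nat \<Rightarrow> nat list \<Rightarrow> nat) \<Rightarrow> (nat \<Rightarrow> nat) \<Rightarrow> bool" where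
  "admissible_digits \<phi> q \<longleftrightarrow> (\<forall>n\<ge>1. q n \<ge> 1 \<and> q n \<ge> perron_r \<phi> q (n - 1) + 1)"

lemma perron_minus_rep_iff:
  "perron_minus_rep \<phi> q x \<longleftrightarrow> admissible_digits \<phi> q \<and> perron_term \<phi> q sums x"
  by (simp add: perron_minus_rep_def admissible_digits_def perron_term_def[abs_def])

lemma perron_functions_shift:
  assumes "perron_functions \<phi>" "d \<ge> 1"
  shows "perron_functions (perron_shift \<phi> d)"
  unfolding perron_functions_def perron_shift_def
proof (intro allI impI)
  fix n and qs :: "nat list" assume "length qs = n \<and> (\<forall>q\<in>set qs. 1 \<le> q)"
  then have "length (d # qs) = Suc n \<and> (\<forall>q\<in>set (d # qs). 1 \<le> q)"
    using assms(2) by simp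
  then show "1 \<le> \<phi> (Suc n) (d # qs)"
    using assms(1) unfolding perron_functions_def by blast
qed

lemma perron_r_shift:
  "perron_r (perron_shift \<phi> (q 1)) (\<lambda>n. q (Suc n)) n = perron_r \<phi> q (Suc n)"
proof -
  have "map q [1..<Suc (Suc n)] = q 1 # map q [Suc 1..<Suc (Suc n)]"
    by (simp add: upt_conv_Cons del: upt_Suc)
  also have "map q [Suc 1..<Suc (Suc n)] = map (\<lambda>n. q (Suc n)) [1..<Suc n]"
    by (simp only: map_Suc_upt[symmetric] map_map o_def)
  finally show ?thesis
    by (simp add: perron_r_def perron_shift_def del: upt_Suc)
qed

lemma perron_r_0: "perron_r \<phi> q 0 = \<phi> 0 []"
  by (simp add: perron_r_def)

lemma perron_term_0: "perron_term \<phi> q 0 = real (\<phi> 0 []) / (real (q 1) - 1)"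
  by (simp add: perron_term_def perron_r_0)

lemma perron_term_Suc:
  "perron_term \<phi> q (Suc n) =
     - (real (\<phi> 0 []) / ((real (q 1) - 1) * real (q 1))) *
       perron_term (perron_shift \<phi> (q 1)) (\<lambda>n. q (Suc n)) n"
proof -
  have num: "(\<Prod>i=0..Suc n. real (perron_r \<phi> q i)) =
      real (\<phi> 0 []) * (\<Prod>i=0..n. real (perron_r \<phi> q (Suc i)))"
    by (simp only: prod.atLeast0_atMost_Suc_shift perron_r_0 o_def)
  have den: "(\<Prod>i=1..Suc n. (real (q i) - 1) * real (q i)) =
      ((real (q 1) - 1) * real (q 1)) * (\<Prod>i=1..n. (real (q (Suc i)) - 1) * real (q (Suc i)))"
    by (subst prod.atLeast_Suc_atMost)
      (simp_all only: prod.shift_bounds_cl_Suc_ivl One_nat_def Suc_le_mono le0)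
  show ?thesis
    unfolding perron_term_def perron_r_shift num den by (simp add: mult_ac)
qed

lemma admissible_digits_shift:
  assumes "admissible_digits \<phi> q"
  shows "admissible_digits (perron_shift \<phi> (q 1)) (\<lambda>n. q (Suc n))"
  unfolding admissible_digits_def
proof (intro allI impI)
  fix n :: nat assume "n \<ge> 1"
  then have "perron_r (perron_shift \<phi> (q 1)) (\<lambda>n. q (Suc n)) (n - 1) = perron_r \<phi> q (Suc n - 1)"
    by (subst perron_r_shift) simp
  then show "1 \<le> q (Suc n) \<and>
      perron_r (perron_shift \<phi> (q 1)) (\<lambda>n. q (Suc n)) (n - 1) + 1 \<le> q (Suc n)"
    using assms unfolding admissible_digits_def by (metis Suc_eq_plus1 le_add2)
qed

lemma first_digit_ge:
  assumes "perron_functions \<phi>" "admissible_digits \<phi> q"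
  shows "1 \<le> \<phi> 0 []" "\<phi> 0 [] + 1 \<le> q 1"
proof -
  show "1 \<le> \<phi> 0 []"
    using assms(1) unfolding perron_functions_def by (metis empty_iff list.set(1) list.size(3))
  show "\<phi> 0 [] + 1 \<le> q 1"
    using assms(2) unfolding admissible_digits_def
    by (metis diff_self_eq_0 order_refl perron_r_0)
qed

text \<open>
  The tail \<open>y\<close> is given by solving the affine relation for it, so that it is visibly a continuous
  function of \<open>x\<close> as long as the first digit stays the same.
\<close>

lemma perron_minus_rep_shift:
  assumes \<phi>: "perron_functions \<phi>" and rep: "perron_minus_rep \<phi> q x"
    and y: "y = (real (\<phi> 0 []) / (real (q 1) - 1) - x) /
                (real (\<phi> 0 []) / ((real (q 1) - 1) * real (q 1)))"
  shows "perron_minus_rep (perron_shift \<phi> (q 1)) (\<lambda>n. q (Suc n)) y"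
    and "x = real (\<phi> 0 []) / (real (q 1) - 1) -
             real (\<phi> 0 []) / ((real (q 1) - 1) * real (q 1)) * y"
proof -
  define c where "c = real (\<phi> 0 []) / ((real (q 1) - 1) * real (q 1))"
  have adm: "admissible_digits \<phi> q" and sums: "perron_term \<phi> q sums x"
    using rep by (auto simp: perron_minus_rep_iff)
  have c: "c > 0"
    using first_digit_ge[OF \<phi> adm] by (auto simp: c_def intro!: divide_pos_pos mult_pos_pos)
  have "(\<lambda>n. perron_term \<phi> q (Suc n)) sums (x - perron_term \<phi> q 0)"
    using sums by (simp add: sums_Suc_iff)
  then have "(\<lambda>n. - (1 / c) * perron_term \<phi> q (Suc n)) sums
      (- (1 / c) * (x - perron_term \<phi> q 0))"
    by (rule sums_mult)
  moreover have "- (1 / c) * perron_term \<phi> q (Suc n) =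
      perron_term (perron_shift \<phi> (q 1)) (\<lambda>n. q (Suc n)) n" for n
    unfolding perron_term_Suc c_def[symmetric] using c by simp
  moreover have "- (1 / c) * (x - perron_term \<phi> q 0) = y"
    unfolding y perron_term_0 c_def[symmetric] by (simp add: diff_divide_distrib)
  ultimately have "perron_term (perron_shift \<phi> (q 1)) (\<lambda>n. q (Suc n)) sums y"
    by simp
  with adm show "perron_minus_rep (perron_shift \<phi> (q 1)) (\<lambda>n. q (Suc n)) y"
    by (simp only: perron_minus_rep_iff admissible_digits_shift)
  show "x = real (\<phi> 0 []) / (real (q 1) - 1) -
             real (\<phi> 0 []) / ((real (q 1) - 1) * real (q 1)) * y"
    unfolding y c_def[symmetric] using c by simp
qed

section \<open>The first digit is determined by the number\<close>

text \<open>
  Expanding the affine map of the first digit around \<open>y = 1\<close> instead of \<open>y = 0\<close> turns the upper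
  bound \<open>y \<le> 1\<close> for the tail into the lower bound \<open>r/q\<close> for the number.
\<close>

lemma affine_at_one:
  fixes r q :: real
  assumes "q > 1"
  shows "r / (q - 1) - r / ((q - 1) * q) * y = r / q + r / ((q - 1) * q) * (1 - y)"
proof -
  have "r / (q - 1) = r / q + r / ((q - 1) * q)"
    using assms by (simp add: divide_simps) (simp add: algebra_simps)
  then show ?thesis
    by (simp add: right_diff_distrib)
qed

text \<open>
  The splitting of the first term holds for partial sums as well, and the affine map sends the unit
  interval into itself because \<open>q\<^sub>1 \<ge> r\<^sub>0 + 1\<close>. This gives an induction on the number of terms.
\<close>

lemma perron_partial_sum_bounds:
  assumes "perron_functions \<phi>" "admissible_digits \<phi> q"
  shows "(\<Sum>i<n. perron_term \<phi> q i) \<in> {0..1}"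
  using assms
proof (induction n arbitrary: \<phi> q)
  case 0
  then show ?case by simp
next
  case (Suc n)
  define r d where "r = real (\<phi> 0 [])" and "d = real (q 1)"
  define y where "y = (\<Sum>i<n. perron_term (perron_shift \<phi> (q 1)) (\<lambda>n. q (Suc n)) i)"
  have rd: "1 \<le> r" "r + 1 \<le> d" "q 1 \<ge> 1"
    using first_digit_ge[OF Suc.prems] by (auto simp: r_def d_def)
  have y: "0 \<le> y" "y \<le> 1"
    using Suc.IH[OF perron_functions_shift[OF Suc.prems(1) rd(3)]
        admissible_digits_shift[OF Suc.prems(2)]] by (auto simp: y_def)
  have eq: "(\<Sum>i<Suc n. perron_term \<phi> q i) = r / (d - 1) - r / ((d - 1) * d) * y"
    unfolding sum.lessThan_Suc_shift perron_term_0 perron_term_Suc sum_distrib_left[symmetric]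
    by (simp add: y_def r_def d_def)
  have c: "0 \<le> r / ((d - 1) * d)"
    using rd by simp
  have "r / (d - 1) - r / ((d - 1) * d) * y \<le> r / (d - 1)"
    using mult_nonneg_nonneg[OF c y(1)] by linarith
  also have "\<dots> \<le> 1"
    using rd by simp
  finally have "r / (d - 1) - r / ((d - 1) * d) * y \<le> 1" .
  moreover have "0 \<le> r / d + r / ((d - 1) * d) * (1 - y)"
    using rd y c by (intro add_nonneg_nonneg mult_nonneg_nonneg) auto
  then have "0 \<le> r / (d - 1) - r / ((d - 1) * d) * y"
    using rd by (subst affine_at_one) auto
  ultimately show ?case
    unfolding eq by simp
qed

lemma perron_minus_rep_in_unit_interval:
  assumes "perron_functions \<phi>" "perron_minus_rep \<phi> q x"
  shows "0 \<le> x" "x \<le> 1"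
proof -
  have bounds: "(\<Sum>i<n. perron_term \<phi> q i) \<in> {0..1}" for n
    using assms perron_partial_sum_bounds by (simp only: perron_minus_rep_iff)
  have lim: "(\<lambda>n. \<Sum>i<n. perron_term \<phi> q i) \<longlonglongrightarrow> x"
    using assms(2) by (simp only: perron_minus_rep_iff sums_def)
  show "0 \<le> x"
    by (rule LIMSEQ_le_const[OF lim]) (use bounds in force)
  show "x \<le> 1"
    by (rule LIMSEQ_le_const2[OF lim]) (use bounds in force)
qed

text \<open>
  The bounds become strict in three steps. The tail satisfies \<open>y \<le> 1\<close>, hence \<open>x \<ge> r\<^sub>0/q\<^sub>1 > 0\<close>.
  Applied to the tail, this gives \<open>y > 0\<close>, hence \<open>x < r\<^sub>0/(q\<^sub>1 - 1) \<le> 1\<close>. Applied to the tail in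
  turn, this gives \<open>y < 1\<close>, hence \<open>x > r\<^sub>0/q\<^sub>1\<close>.
\<close>

lemma perron_minus_rep_pos:
  assumes "perron_functions \<phi>" "perron_minus_rep \<phi> q x"
  shows "0 < x"
proof -
  define r d where "r = real (\<phi> 0 [])" and "d = real (q 1)"
  have rd: "1 \<le> r" "r + 1 \<le> d" "q 1 \<ge> 1"
    using first_digit_ge[OF assms(1)] assms(2)
    by (fastforce simp: r_def d_def perron_minus_rep_iff)+
  obtain y where y: "perron_minus_rep (perron_shift \<phi> (q 1)) (\<lambda>n. q (Suc n)) y"
    and x: "x = r / (d - 1) - r / ((d - 1) * d) * y"
    unfolding r_def d_def using perron_minus_rep_shift[OF assms refl] by blast
  have "y \<le> 1"
    using perron_minus_rep_in_unit_interval[OF perron_functions_shift y] assms(1) rd by simp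
  then have "0 < r / d + r / ((d - 1) * d) * (1 - y)"
    using rd by (intro add_pos_nonneg mult_nonneg_nonneg) auto
  then show ?thesis
    using rd x by (subst x, subst affine_at_one) auto
qed

lemma perron_minus_rep_less:
  assumes "perron_functions \<phi>" "perron_minus_rep \<phi> q x"
  shows "x < real (\<phi> 0 []) / (real (q 1) - 1)"
proof -
  define r d where "r = real (\<phi> 0 [])" and "d = real (q 1)"
  have rd: "1 \<le> r" "r + 1 \<le> d" "q 1 \<ge> 1"
    using first_digit_ge[OF assms(1)] assms(2)
    by (fastforce simp: r_def d_def perron_minus_rep_iff)+
  obtain y where y: "perron_minus_rep (perron_shift \<phi> (q 1)) (\<lambda>n. q (Suc n)) y"
    and x: "x = r / (d - 1) - r / ((d - 1) * d) * y"
    unfolding r_def d_def using perron_minus_rep_shift[OF assms refl] by blast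
  have "0 < y"
    using perron_minus_rep_pos[OF perron_functions_shift y] assms(1) rd by simp
  then have "0 < r / ((d - 1) * d) * y"
    using rd by (intro mult_pos_pos divide_pos_pos) auto
  then show ?thesis
    using x by (simp add: r_def d_def)
qed

lemma perron_minus_rep_first_digit_bounds:
  assumes "perron_functions \<phi>" "perron_minus_rep \<phi> q x"
  shows "x \<in> {real (\<phi> 0 []) / real (q 1) <..< real (\<phi> 0 []) / (real (q 1) - 1)}"
proof -
  define r d where "r = real (\<phi> 0 [])" and "d = real (q 1)"
  have rd: "1 \<le> r" "r + 1 \<le> d" "q 1 \<ge> 1"
    using first_digit_ge[OF assms(1)] assms(2)
    by (fastforce simp: r_def d_def perron_minus_rep_iff)+
  obtain y where y: "perron_minus_rep (perron_shift \<phi> (q 1)) (\<lambda>n. q (Suc n)) y"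
    and x: "x = r / (d - 1) - r / ((d - 1) * d) * y"
    unfolding r_def d_def using perron_minus_rep_shift[OF assms refl] by blast
  define r' d' where "r' = real (perron_shift \<phi> (q 1) 0 [])" and "d' = real (q (Suc 1))"
  have \<phi>': "perron_functions (perron_shift \<phi> (q 1))"
    using perron_functions_shift assms(1) rd by blast
  have "y < r' / (d' - 1)"
    using perron_minus_rep_less[OF \<phi>' y] by (simp add: r'_def d'_def)
  also have "1 \<le> r'" "r' + 1 \<le> d'"
    using first_digit_ge[OF \<phi>'] y by (fastforce simp: r'_def d'_def perron_minus_rep_iff)+
  then have "r' / (d' - 1) \<le> 1"
    by simp
  finally have "0 < r / ((d - 1) * d) * (1 - y)"
    using rd by (intro mult_pos_pos divide_pos_pos) auto
  then have "r / d < x"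
    using rd unfolding x by (subst affine_at_one) auto
  then show ?thesis
    using perron_minus_rep_less[OF assms] by (simp add: r_def d_def)
qed

text \<open>The bounds say that \<open>q\<^sub>1 - 1 < r\<^sub>0/x < q\<^sub>1\<close>, which leaves one integer value for \<open>q\<^sub>1\<close>.\<close>

lemma perron_minus_rep_first_digit_eqI:
  assumes "perron_functions \<phi>" "perron_minus_rep \<phi> q x" "perron_minus_rep \<phi> q' x'"
    and "x' \<in> {real (\<phi> 0 []) / real (q 1) <..< real (\<phi> 0 []) / (real (q 1) - 1)}"
  shows "q' 1 = q 1"
proof -
  define r where "r = real (\<phi> 0 [])"
  have d: "1 < real (q 1)" and d': "1 < real (q' 1)"
    using first_digit_ge[OF assms(1)] assms(2,3) by (fastforce simp: perron_minus_rep_iff)+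
  have x': "0 < x'"
    using perron_minus_rep_pos assms by blast
  have "real (q 1) - 1 < r / x'" "r / x' < real (q 1)"
    using assms(4) d x' by (simp_all add: r_def field_simps)
  moreover have "real (q' 1) - 1 < r / x'" "r / x' < real (q' 1)"
    using perron_minus_rep_first_digit_bounds[OF assms(1,3)] d' x'
    by (simp_all add: r_def field_simps)
  ultimately show ?thesis
    by linarith
qed

section \<open>Common digits and distance\<close>

text \<open>
  Open conditions propagate along the digits: the first digit is constant on an open interval around
  \<open>x\<close>, and there the tail is one fixed continuous function of the number.
\<close>

lemma perron_minus_rep_eventually_same_digits:
  assumes "perron_functions \<phi>" "perron_minus_rep \<phi> q x"
  shows "\<forall>\<^sub>F z in nhds x. \<forall>q'. perron_minus_rep \<phi> q' z \<longrightarrow> (\<forall>i\<in>{1..m}. q' i = q i)"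
  using assms
proof (induction m arbitrary: \<phi> q x)
  case 0
  then show ?case by simp
next
  case (Suc m)
  let ?\<phi>' = "perron_shift \<phi> (q 1)" and ?q' = "\<lambda>n. q (Suc n)"
  define tail where "tail z = (real (\<phi> 0 []) / (real (q 1) - 1) - z) /
      (real (\<phi> 0 []) / ((real (q 1) - 1) * real (q 1)))" for z
  have q1: "q 1 \<ge> 1" "1 \<le> \<phi> 0 []" "\<phi> 0 [] + 1 \<le> q 1"
    using first_digit_ge[OF Suc.prems(1)] Suc.prems(2)
    by (fastforce simp: perron_minus_rep_iff)+
  have "\<forall>\<^sub>F z in nhds (tail x). \<forall>p. perron_minus_rep ?\<phi>' p z \<longrightarrow> (\<forall>i\<in>{1..m}. p i = ?q' i)"
    using Suc.IH[OF perron_functions_shift[OF Suc.prems(1) q1(1)]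
        perron_minus_rep_shift(1)[OF Suc.prems tail_def]] .
  moreover have "(tail \<longlongrightarrow> tail x) (nhds x)"
    unfolding tail_def using q1 by (intro tendsto_intros) (auto simp: filterlim_ident)
  ultimately have tail: "\<forall>\<^sub>F z in nhds x.
      \<forall>p. perron_minus_rep ?\<phi>' p (tail z) \<longrightarrow> (\<forall>i\<in>{1..m}. p i = ?q' i)"
    by (rule eventually_compose_filterlim)
  have first: "\<forall>\<^sub>F z in nhds x.
      z \<in> {real (\<phi> 0 []) / real (q 1) <..< real (\<phi> 0 []) / (real (q 1) - 1)}"
    using perron_minus_rep_first_digit_bounds[OF Suc.prems]
    by (intro eventually_nhds_in_open) auto
  show ?case
    using first tail
  proof eventually_elim
    case (elim z)
    show ?case
    proof (intro allI impI ballI)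
      fix p i assume p: "perron_minus_rep \<phi> p z" and i: "i \<in> {1..Suc m}"
      have p1: "p 1 = q 1"
        using perron_minus_rep_first_digit_eqI[OF Suc.prems p elim(1)] .
      have "perron_minus_rep (perron_shift \<phi> (p 1)) (\<lambda>n. p (Suc n)) (tail z)"
        by (rule perron_minus_rep_shift(1)[OF Suc.prems(1) p]) (simp only: p1 tail_def)
      then have "\<forall>i\<in>{1..m}. p (Suc i) = q (Suc i)"
        using elim(2) unfolding p1 by blast
      with p1 i show "p i = q i"
        by (cases i; cases "i = 1") auto
    qed
  qed
qed

text \<open>A neighbourhood of \<open>x\<close> contains \<open>x\<close> itself, so constancy of the digits near \<open>x\<close> is enough.\<close>

lemma perron_minus_rep_unique:
  assumes "perron_functions \<phi>" "perron_minus_rep \<phi> q x" "perron_minus_rep \<phi> q' x" "n \<ge> 1"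
  shows "q' n = q n"
  using eventually_nhds_x_imp_x[OF perron_minus_rep_eventually_same_digits[OF assms(1,2), of n]]
    assms(3,4) by auto

lemma perron_minus_digit_eq:
  assumes "perron_functions \<phi>" "perron_minus_rep \<phi> q x" "n \<ge> 1"
  shows "perron_minus_digit \<phi> n x = q n"
  unfolding perron_minus_digit_def
  by (rule the_equality) (use assms perron_minus_rep_unique in blast)+

text \<open>
  Each common digit contributes a factor \<open>r\<^sub>0/((q\<^sub>1 - 1) q\<^sub>1) \<le> 1/q\<^sub>1 \<le> 1/2\<close>, and the tails left over
  lie in the unit interval.
\<close>

lemma perron_minus_rep_dist_le:
  assumes "perron_functions \<phi>" "perron_minus_rep \<phi> q x" "perron_minus_rep \<phi> q' x'"
    and "\<And>i. i \<in> {1..m} \<Longrightarrow> q' i = q i"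
  shows "\<bar>x' - x\<bar> \<le> (1 / 2) ^ m"
  using assms
proof (induction m arbitrary: \<phi> q q' x x')
  case 0
  then show ?case
    using perron_minus_rep_in_unit_interval[of \<phi> q x] perron_minus_rep_in_unit_interval[of \<phi> q' x']
    by (auto simp: abs_le_iff)
next
  case (Suc m)
  define r d where "r = real (\<phi> 0 [])" and "d = real (q 1)"
  have rd: "1 \<le> r" "r + 1 \<le> d" "q 1 \<ge> 1"
    using first_digit_ge[OF Suc.prems(1)] Suc.prems(2)
    by (fastforce simp: r_def d_def perron_minus_rep_iff)+
  have q1: "q' 1 = q 1"
    using Suc.prems(4) by simp
  obtain y where y: "perron_minus_rep (perron_shift \<phi> (q 1)) (\<lambda>n. q (Suc n)) y"
    and x: "x = r / (d - 1) - r / ((d - 1) * d) * y"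
    unfolding r_def d_def using perron_minus_rep_shift[OF Suc.prems(1,2) refl] by blast
  obtain y' where y': "perron_minus_rep (perron_shift \<phi> (q 1)) (\<lambda>n. q' (Suc n)) y'"
    and x': "x' = r / (d - 1) - r / ((d - 1) * d) * y'"
    unfolding r_def d_def using perron_minus_rep_shift[OF Suc.prems(1,3) refl, unfolded q1] by blast
  have IH: "\<bar>y' - y\<bar> \<le> (1 / 2) ^ m"
    using Suc.prems(4)
    by (intro Suc.IH[OF perron_functions_shift[OF Suc.prems(1) rd(3)] y y']) auto
  have "r * 2 \<le> (d - 1) * d"
    using rd by (intro mult_mono) auto
  then have c: "\<bar>r / ((d - 1) * d)\<bar> \<le> 1 / 2"
    using rd by (simp add: field_simps)
  have "x' - x = - (r / ((d - 1) * d)) * (y' - y)"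
    unfolding x x' by (simp add: right_diff_distrib)
  then have "\<bar>x' - x\<bar> = \<bar>r / ((d - 1) * d)\<bar> * \<bar>y' - y\<bar>"
    by (simp only: abs_mult abs_minus_cancel)
  also have "\<dots> \<le> 1 / 2 * (1 / 2) ^ m"
    using c IH by (intro mult_mono) auto
  finally show ?case by simp
qed

lemma perron_minus_rep_eqI:
  assumes "perron_functions \<phi>" "perron_minus_rep \<phi> q x" "perron_minus_rep \<phi> q' x'"
    and "\<And>i. i \<ge> 1 \<Longrightarrow> q' i = q i"
  shows "x' = x"
proof -
  have "\<bar>x' - x\<bar> \<le> 0"
  proof (rule LIMSEQ_le_const)
    show "(\<lambda>m. (1 / 2 :: real) ^ m) \<longlonglongrightarrow> 0"
      by (rule LIMSEQ_power_zero) simp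
    show "\<exists>N. \<forall>m\<ge>N. \<bar>x' - x\<bar> \<le> (1 / 2) ^ m"
      using perron_minus_rep_dist_le[OF assms(1-3)] assms(4) by simp
  qed
  then show ?thesis by simp
qed

section \<open>Convergence in terms of digits\<close>

theorem proposition6:
  fixes \<phi> :: "nat \<Rightarrow> nat list \<Rightarrow> nat"
    and x0 :: real and x :: "nat \<Rightarrow> real" and k :: "nat \<Rightarrow> nat"
  assumes "perron_functions \<phi>"
    and "x0 \<in> {0<..<1} - perron_minus_IS \<phi>"
    and "\<And>n. n \<ge> 1 \<Longrightarrow> x n \<in> {0<..<1} - (perron_minus_IS \<phi> \<union> {x0})"
    and "\<And>n. n \<ge> 1 \<Longrightarrow>
           k n = (LEAST j. j \<ge> 1 \<and> perron_minus_digit \<phi> j (x n) \<noteq> perron_minus_digit \<phi> j x0)"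
  shows "x \<longlonglongrightarrow> x0 \<longleftrightarrow> filterlim k at_top sequentially"
proof -
  note \<phi> = assms(1)
  obtain q0 where q0: "perron_minus_rep \<phi> q0 x0"
    using assms(2) by (auto simp: perron_minus_IS_def)
  have "\<exists>q. perron_minus_rep \<phi> q (x n)" if "n \<ge> 1" for n
    using assms(3)[OF that] by (auto simp: perron_minus_IS_def)
  then obtain q where q: "\<And>n. n \<ge> 1 \<Longrightarrow> perron_minus_rep \<phi> (q n) (x n)"
    by metis
  have digit: "perron_minus_digit \<phi> j (x n) \<noteq> perron_minus_digit \<phi> j x0 \<longleftrightarrow> q n j \<noteq> q0 j"
    if "n \<ge> 1" "j \<ge> 1" for n j
    using perron_minus_digit_eq[OF \<phi> q0] perron_minus_digit_eq[OF \<phi> q] that by simp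
  have k: "k n = (LEAST j. j \<ge> 1 \<and> q n j \<noteq> q0 j)" if "n \<ge> 1" for n
    unfolding assms(4)[OF that] using digit[OF that] by (metis (lifting))
  \<comment> \<open>Since \<open>x n \<noteq> x0\<close>, some digit differs, so the minimum is attained.\<close>
  have differ: "k n \<ge> 1" "q n (k n) \<noteq> q0 (k n)" if n: "n \<ge> 1" for n
  proof -
    have "\<exists>j. j \<ge> 1 \<and> q n j \<noteq> q0 j"
      using perron_minus_rep_eqI[OF \<phi> q0 q[OF n]] assms(3)[OF n] by blast
    then show "k n \<ge> 1" "q n (k n) \<noteq> q0 (k n)"
      unfolding k[OF n] by (smt (verit, best) LeastI)+
  qed
  have agree: "q n i = q0 i" if "n \<ge> 1" "1 \<le> i" "i < k n" for n i
    using not_less_Least[of i "\<lambda>j. j \<ge> 1 \<and> q n j \<noteq> q0 j"] that k by auto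
  have pos: "\<forall>\<^sub>F n in sequentially. n \<ge> 1"
    by (rule eventually_ge_at_top)
  show ?thesis
  proof
    assume lim: "x \<longlonglongrightarrow> x0"
    show "filterlim k at_top sequentially"
      unfolding filterlim_at_top
    proof
      fix m
      have "\<forall>\<^sub>F n in sequentially.
          \<forall>p. perron_minus_rep \<phi> p (x n) \<longrightarrow> (\<forall>i\<in>{1..m}. p i = q0 i)"
        using eventually_compose_filterlim[OF perron_minus_rep_eventually_same_digits[OF \<phi> q0] lim] .
      then show "\<forall>\<^sub>F n in sequentially. m \<le> k n"
        using pos
      proof eventually_elim
        case (elim n)
        then have "\<forall>i\<in>{1..m}. q n i = q0 i"
          using q by blast
        with differ[OF elim(2)] show ?case
          by (meson atLeastAtMost_iff nle_le)
      qed
    qed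
  next
    assume lim: "filterlim k at_top sequentially"
    have "\<forall>\<^sub>F n in sequentially. norm (x n - x0) \<le> norm ((1 / 2 :: real) ^ (k n - 1)) * 1"
      using pos
    proof eventually_elim
      case (elim n)
      have "\<bar>x n - x0\<bar> \<le> (1 / 2) ^ (k n - 1)"
      proof (rule perron_minus_rep_dist_le[OF \<phi> q0 q[OF elim]])
        fix i assume "i \<in> {1..k n - 1}"
        then show "q n i = q0 i"
          using differ(1)[OF elim] by (intro agree[OF elim]) auto
      qed
      then show ?case by simp
    qed
    moreover have "(\<lambda>n. (1 / 2 :: real) ^ (k n - 1)) \<longlonglongrightarrow> 0"
    proof (rule filterlim_compose[OF _ lim])
      have "(\<lambda>j. (1 / 2 :: real) ^ (Suc j - 1)) \<longlonglongrightarrow> 0"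
        by (simp add: LIMSEQ_power_zero)
      then show "(\<lambda>j. (1 / 2 :: real) ^ (j - 1)) \<longlonglongrightarrow> 0"
        by (subst (asm) filterlim_sequentially_Suc)
    qed
    ultimately have "(\<lambda>n. x n - x0) \<longlonglongrightarrow> 0"
      by (rule tendsto_0_le[rotated])
    then show "x \<longlonglongrightarrow> x0"
      by (simp add: LIM_zero_iff)
  qed
qed

end
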